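(* Let $a,b$ be integers with $0<a<b$ and $\gcd(a,b)=1$. Write $\frac{a}{b}=[0,a_1,\ldots,a_n]$ as a regular continued fraction with all partial quotients $a_1,\ldots,a_n$ positive integers and with $n$ odd. Let $a^*$ be the integer with $0<a^*<b$ and $aa^*\equiv 1 \pmod b$, and let $k$ be the positive integer with $aa^*=1+kb$. Define $T(a,b)=\sum_{j=1}^n(-1)^{j-1}a_j$ and $D(a,b)=\sum_{j=1}^n a_j$. Then: (1) If $a\equiv 1 \pmod 4$ or $a^*\equiv 1\pmod 4$, then $T(a,b)\equiv b-k \pmod 4$. (2) If $a\equiv 3 \pmod 4$ or $a^*\equiv 3\pmod 4$, then $T(a,b)\equiv 2+k-b \pmod 4$. (3) If $a\equiv 2 \pmod 4$ or $a^*\equiv 2\pmod 4$, then $b-k$ is even and $D(a,b)\equiv (b-k)/2 \pmod 2$.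
   Context: The requirement that $n$ be odd (rather than $a_n\ge 2$) makes the expansion unique: if the usual expansion has even length with last quotient $a_n\ge2$, one uses $[0,a_1,\ldots,a_n-1,1]$; if it has even length with $a_n=1$, one uses $[0,a_1,\ldots,a_{n-1}+1]$. *)

theory Defs
  imports Complex_Main "HOL-Number_Theory.Cong"
begin

text \<open>The value of the finite continued fraction \<open>[c\<^sub>0, c\<^sub>1, \<dots>, c\<^sub>n]\<close>; the empty list is a
  dummy case.\<close>

fun cfrac_value :: "int list \<Rightarrow> rat" where
  "cfrac_value [] = 0"
| "cfrac_value [c] = of_int c"
| "cfrac_value (c # d # cs) = of_int c + 1 / cfrac_value (d # cs)"

text \<open>\<open>q j\<close> is the partial quotient \<open>a\<^sub>j\<close> for \<open>1 \<le> j \<le> n\<close>; other values of \<open>q\<close> are irrelevant.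
  The parity condition on \<open>n\<close> makes the expansion of a rational in \<open>(0, 1)\<close> unique, so the two
  sums below depend only on \<open>a\<close> and \<open>b\<close>.\<close>

definition odd_cfrac_expansion :: "int \<Rightarrow> int \<Rightarrow> nat \<Rightarrow> (nat \<Rightarrow> int) \<Rightarrow> bool" where
  "odd_cfrac_expansion a b n q \<longleftrightarrow>
     odd n \<and> (\<forall>j\<in>{1..n}. q j > 0) \<and>
     of_int a / of_int b = cfrac_value (0 # map q [1..<n + 1])"

definition cfrac_alt_sum :: "nat \<Rightarrow> (nat \<Rightarrow> int) \<Rightarrow> int" where
  "cfrac_alt_sum n q = (\<Sum>j = 1..n. (- 1) ^ (j - 1) * q j)"

definition cfrac_sum :: "nat \<Rightarrow> (nat \<Rightarrow> int) \<Rightarrow> int" where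
  "cfrac_sum n q = (\<Sum>j = 1..n. q j)"

end

theory Submission
  imports Defs
begin

text \<open>
  The abelianization of \<open>SL\<^sub>2(\<int>)\<close> gives a character \<open>\<chi>\<close> with values in \<open>\<int>/12\<int>\<close> that sends the
  two elementary unipotent matrices to \<open>1\<close> and \<open>-1\<close>. The matrix with rows \<open>(a*, b)\<close> and \<open>(k, a)\<close>
  holds the last two convergents of \<open>[0, a\<^sub>1, \<dots>, a\<^sub>n]\<close>. As \<open>n\<close> is odd, it is the product of the
  unipotent matrices with entries \<open>a\<^sub>1, \<dots>, a\<^sub>n\<close>, alternately upper and lower, so its character is
  \<open>T(a, b)\<close> mod 12. An explicit formula for \<open>\<chi>\<close>, symmetric under exchange of \<open>a\<close> and \<open>a*\<close>, then
  gives the three claims by reduction mod 4.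
\<close>

section \<open>Congruences and coprime integers\<close>

lemma cong_12_iff:
  fixes x y :: int
  shows "[x = y] (mod 12) \<longleftrightarrow> [x = y] (mod 3) \<and> [x = y] (mod 4)"
  unfolding cong_iff_dvd_diff by presburger

lemma cong_half:
  fixes m s z :: int
  assumes "[2 * s = z] (mod 2 * m)"
  shows "even z" "[s = z div 2] (mod m)"
proof -
  obtain w where "z = 2 * s + 2 * m * w"
    using assms by (auto simp: cong_iff_lin)
  then have "z = 2 * (s + m * w)"
    by (simp add: algebra_simps)
  then show "even z" "[s = z div 2] (mod m)"
    by (simp_all add: cong_iff_dvd_diff)
qed

lemma four_dvd_one_minus_square:
  fixes c :: int
  assumes "odd c"
  shows "4 dvd 1 - c\<^sup>2"
  using assms by (auto elim!: oddE simp: power2_eq_square algebra_simps)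

lemma three_dvd_one_minus_square:
  fixes c :: int
  assumes "\<not> 3 dvd c"
  shows "3 dvd 1 - c\<^sup>2"
proof -
  have "3 dvd 1 - c \<or> 3 dvd 1 + c"
    using assms by presburger
  then have "3 dvd (1 - c) * (1 + c)"
    by auto
  then show ?thesis
    by (simp add: power2_eq_square algebra_simps)
qed

lemma one_minus_squares_cong_0:
  fixes c d :: int
  assumes "coprime c d"
  shows "[(1 - c\<^sup>2) * (1 - d\<^sup>2) = 0] (mod 12)"
proof -
  have "odd c \<or> odd d" "\<not> 3 dvd c \<or> \<not> 3 dvd d"
    using assms by (auto dest: coprime_common_divisor)
  then have "4 dvd (1 - c\<^sup>2) * (1 - d\<^sup>2)" "3 dvd (1 - c\<^sup>2) * (1 - d\<^sup>2)"
    using four_dvd_one_minus_square three_dvd_one_minus_square by (meson dvd_mult dvd_mult2)+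
  then show ?thesis
    by (simp add: cong_12_iff cong_0_iff)
qed

lemma coprime_if_det_eq_1:
  fixes a b c d :: "'a :: {idom, algebraic_semidom}"
  assumes "a * d - b * c = 1"
  shows "coprime c d"
proof (rule coprimeI)
  fix e assume "e dvd c" "e dvd d"
  then have "e dvd a * d - b * c" by simp
  then show "is_unit e" using assms by simp
qed

lemma bezout_coefficients_unique:
  fixes a b x y x' y' :: int
  assumes "a * x - y * b = 1" "a * x' - y' * b = 1"
    and "0 < x" "x \<le> b" "0 < x'" "x' \<le> b"
  shows "x = x'" "y = y'"
proof -
  have diff: "a * (x - x') = (y - y') * b"
    using assms(1,2) by (simp add: algebra_simps)
  have "coprime b a"
    using coprime_if_det_eq_1[of x a y b] assms(1) by (simp add: mult.commute coprime_commute)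
  then have "b dvd x - x'"
    using diff by (metis coprime_dvd_mult_right_iff dvd_triv_right)
  moreover have "\<bar>x - x'\<bar> < b"
    using assms(3-6) by auto
  ultimately show "x = x'"
    using dvd_imp_le_int[of "x - x'" b] by auto
  then show "y = y'"
    using diff assms(3,4) by simp
qed

lemma coprime_fraction_unique:
  fixes a b p q :: int
  assumes "of_int a / of_int b = (of_int p / of_int q :: rat)"
    and "coprime a b" "coprime p q" "0 < b" "0 < q"
  shows "a = p" "b = q"
proof -
  have "quotient_of (Fract a b) = quotient_of (Fract p q)"
    using assms(1) by (simp add: Fract_of_int_quotient)
  then show "a = p" "b = q"
    using assms(2-5) by (simp_all add: quotient_of_Fract)
qed

section \<open>The character of \<open>SL\<^sub>2(\<int>)\<close> of order 12\<close>

text \<open>Kubert and Lang's formula for the character at the matrix with rows \<open>(a, b)\<close> and \<open>(c, d)\<close>;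
  it is meaningful modulo 12 and for determinant 1 only.\<close>

definition sl2_character :: "int \<Rightarrow> int \<Rightarrow> int \<Rightarrow> int \<Rightarrow> int" where
  "sl2_character a b c d =
     (1 - c\<^sup>2) * (b * d + 3 * (c - 1) * d + c + 3) + c * (a + d - 3)"

lemma sl2_character_cong:
  assumes "[a = a'] (mod m)" "[b = b'] (mod m)" "[c = c'] (mod m)" "[d = d'] (mod m)"
  shows "[sl2_character a b c d = sl2_character a' b' c' d'] (mod m)"
  unfolding sl2_character_def
  by (intro cong_add cong_mult cong_diff cong_pow cong_refl assms)

lemma sl2_character_upper_unipotent:
  assumes "a * d - b * c = 1"
  shows "[sl2_character (a + x * c) (b + x * d) c d = sl2_character a b c d + x] (mod 12)"
proof -
  have "sl2_character (a + x * c) (b + x * d) c d - (sl2_character a b c d + x) =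
    - x * ((1 - c\<^sup>2) * (1 - d\<^sup>2))"
    by (simp add: sl2_character_def power2_eq_square algebra_simps)
  then show ?thesis
    using one_minus_squares_cong_0[OF coprime_if_det_eq_1[OF assms]]
    by (simp add: cong_iff_dvd_diff)
qed

text \<open>Conjugation by the diagonal matrix with entries \<open>1\<close> and \<open>-1\<close> inverts the unipotent
  generators, so the conjugate of the inverse has the same character; conjugation by the
  transposition interchanges upper and lower generators, so it changes the sign.\<close>

lemma sl2_character_symmetries_on_residues:
  fixes m :: int
  assumes "m = 3 \<or> m = 4"
  shows "\<forall>a\<in>{0..<m}. \<forall>b\<in>{0..<m}. \<forall>c\<in>{0..<m}. \<forall>d\<in>{0..<m}. [a * d - b * c = 1] (mod m) \<longrightarrow>
    [sl2_character d b c a = sl2_character a b c d] (mod m) \<and>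
    [sl2_character d c b a = - sl2_character a b c d] (mod m)"
proof -
  have "{0..<3::int} = {0, 1, 2}" "{0..<4::int} = {0, 1, 2, 3}" by auto
  then show ?thesis
    using assms by (elim disjE) (simp_all add: sl2_character_def cong_def)
qed

lemma sl2_character_symmetries_mod:
  fixes m :: int
  assumes "m = 3 \<or> m = 4" and "a * d - b * c = 1"
  shows "[sl2_character d b c a = sl2_character a b c d] (mod m) \<and>
    [sl2_character d c b a = - sl2_character a b c d] (mod m)"
proof -
  define r where "r x = x mod m" for x
  have r: "[r x = x] (mod m)" "r x \<in> {0..<m}" for x
    using assms(1) by (auto simp: r_def)
  have "[r a * r d - r b * r c = a * d - b * c] (mod m)"
    by (intro cong_diff cong_mult r)
  then have
    "[sl2_character (r d) (r b) (r c) (r a) = sl2_character (r a) (r b) (r c) (r d)] (mod m)"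
    "[sl2_character (r d) (r c) (r b) (r a) = - sl2_character (r a) (r b) (r c) (r d)] (mod m)"
    using sl2_character_symmetries_on_residues[OF assms(1)] assms(2) r(2) by simp_all
  moreover have "[sl2_character (r x) (r y) (r z) (r w) = sl2_character x y z w] (mod m)"
    for x y z w
    by (intro sl2_character_cong r)
  ultimately show ?thesis
    by (meson cong_minus_minus_iff cong_sym cong_trans)
qed

lemma sl2_character_swap_diagonal:
  assumes "a * d - b * c = 1"
  shows "[sl2_character d b c a = sl2_character a b c d] (mod 12)"
  using sl2_character_symmetries_mod[OF _ assms] by (simp add: cong_12_iff)

lemma sl2_character_reverse:
  assumes "a * d - b * c = 1"
  shows "[sl2_character d c b a = - sl2_character a b c d] (mod 12)"
  using sl2_character_symmetries_mod[OF _ assms] by (simp add: cong_12_iff)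

lemma sl2_character_lower_unipotent:
  assumes "a * d - b * c = 1"
  shows "[sl2_character a b (c + x * a) (d + x * b) = sl2_character a b c d - x] (mod 12)"
proof -
  have det: "a * (d + x * b) - b * (c + x * a) = 1" "d * a - c * b = 1"
    using assms by (simp_all add: algebra_simps)
  have "[- sl2_character a b (c + x * a) (d + x * b) =
    sl2_character (d + x * b) (c + x * a) b a] (mod 12)"
    using det(1) by (intro cong_sym[OF sl2_character_reverse])
  also have "[sl2_character (d + x * b) (c + x * a) b a = sl2_character d c b a + x] (mod 12)"
    using det(2) by (rule sl2_character_upper_unipotent)
  also have "[sl2_character d c b a + x = - sl2_character a b c d + x] (mod 12)"
    using assms by (intro cong_add cong_refl sl2_character_reverse)
  finally show ?thesis
    by (subst cong_minus_minus_iff[symmetric]) (simp add: algebra_simps)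
qed

lemma sl2_character_mod_4_diagonal_odd:
  assumes "a * d - b * c = 1" and "odd r" and "[d = r] (mod 4)"
  shows "[sl2_character a b c d = r * (b - c - 1) + 1] (mod 4)"
proof -
  obtain e where e: "r = 2 * e + 1"
    using assms(2) by (rule oddE)
  have "[a = a * r\<^sup>2] (mod 4)"
    using four_dvd_one_minus_square[OF assms(2)] dvd_mult[of 4 "1 - r\<^sup>2" a]
    by (simp add: cong_iff_dvd_diff algebra_simps)
  also have "a * r\<^sup>2 = r * (a * r)"
    by (simp add: power2_eq_square)
  also have "[\<dots> = r * (a * d)] (mod 4)"
    using assms(3) by (intro cong_scalar_left cong_sym[of d])
  also have "a * d = 1 + b * c"
    using assms(1) by simp
  finally have a: "[a = r * (1 + b * c)] (mod 4)" .
  define t where "t = 3 * c + 1 + 3 * (1 - c\<^sup>2) * (c - 1)"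
  have "even t"
    by (simp add: t_def)
  then have "4 dvd 4 * (c * (1 - c\<^sup>2)) + 2 * (e * t)"
    by (auto elim!: evenE)
  also have "4 * (c * (1 - c\<^sup>2)) + 2 * (e * t) =
      sl2_character (r * (1 + b * c)) b c r - (r * (b - c - 1) + 1)"
    unfolding sl2_character_def e t_def by (simp add: power2_eq_square algebra_simps)
  finally have "[sl2_character (r * (1 + b * c)) b c r = r * (b - c - 1) + 1] (mod 4)"
    by (simp only: cong_iff_dvd_diff)
  then show ?thesis
    using sl2_character_cong[OF a cong_refl cong_refl assms(3)] cong_trans by blast
qed

lemma sl2_character_mod_4_diagonal_2:
  assumes "a * d - b * c = 1" and "[d = 2] (mod 4)"
  shows "[2 * sl2_character a b c d = b - c] (mod 4)"
proof -
  have "even d"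
    using assms(2) by (simp add: cong_def) presburger
  then have "odd c"
    using assms(1) by (auto dest: arg_cong[where f = even])
  then have c: "4 dvd 1 - c\<^sup>2"
    by (rule four_dvd_one_minus_square)
  have "a * d - 1 = b * c"
    using assms(1) by simp
  then have "b - c * (a * d - 1) = b * (1 - c\<^sup>2)"
    by (simp add: power2_eq_square right_diff_distrib)
  then have b: "[b = c * (a * d - 1)] (mod 4)"
    using c by (simp add: cong_iff_dvd_diff)
  have "sl2_character a b c 2 - c * (a - 1) =
      (1 - c\<^sup>2) * (b * 2 + 3 * (c - 1) * 2 + c + 3)"
    by (simp add: sl2_character_def)
  then have diag_2: "[sl2_character a b c 2 = c * (a - 1)] (mod 4)"
    using c by (simp add: cong_iff_dvd_diff)
  have "[2 * sl2_character a b c d = 2 * sl2_character a b c 2] (mod 4)"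
    using assms(2) by (intro cong_scalar_left sl2_character_cong cong_refl)
  also have "[2 * sl2_character a b c 2 = 2 * (c * (a - 1))] (mod 4)"
    using diag_2 by (rule cong_scalar_left)
  also have "2 * (c * (a - 1)) = c * (a * 2 - 1) - c"
    by (simp add: algebra_simps)
  also have "[\<dots> = c * (a * d - 1) - c] (mod 4)"
    using assms(2) by (intro cong_diff cong_mult cong_refl cong_sym[of d])
  also have "[c * (a * d - 1) - c = b - c] (mod 4)"
    using b by (intro cong_diff cong_refl cong_sym[of b])
  finally show ?thesis .
qed

section \<open>Convergents\<close>

text \<open>\<open>convergents xs p' p q' q\<close> states that \<open>p' / q'\<close> and \<open>p / q\<close> are the last two convergents
  of the continued fraction \<open>[0, xs]\<close>.\<close>

inductive convergents :: "int list \<Rightarrow> int \<Rightarrow> int \<Rightarrow> int \<Rightarrow> int \<Rightarrow> bool" where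
  Nil: "convergents [] 1 0 0 1"
| Cons: "convergents xs p' p q' q \<Longrightarrow> convergents (x # xs) q' q (p' + x * q') (p + x * q)"

lemma convergents_exist: "\<exists>p' p q' q. convergents xs p' p q' q"
  by (induction xs) (blast intro: convergents.intros)+

lemma convergents_det:
  "convergents xs p' p q' q \<Longrightarrow> p' * q - p * q' = (- 1) ^ length xs"
  by (induction rule: convergents.induct) (simp_all add: algebra_simps)

lemma convergents_nonneg:
  assumes "convergents xs p' p q' q" and "\<forall>x\<in>set xs. 0 < x"
  shows "0 \<le> p' \<and> 0 \<le> p \<and> 0 \<le> q' \<and> 0 < q"
  using assms by (induction rule: convergents.induct) (auto intro: add_nonneg_pos)

lemma convergents_mono:
  assumes "convergents xs p' p q' q" and "\<forall>x\<in>set xs. 0 < x" and "xs \<noteq> []"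
  shows "p' \<le> p \<and> 0 < q' \<and> q' \<le> q"
  using assms
proof (induction rule: convergents.induct)
  case (Cons xs p' p q' q x)
  show ?case
  proof (cases "xs = []")
    case True
    with Cons show ?thesis by (auto elim: convergents.cases)
  next
    case False
    with Cons have "p' \<le> p" "0 < q'" "q' \<le> q" "0 \<le> p'" "0 < x"
      using convergents_nonneg[OF Cons.hyps] by auto
    then show ?thesis by (auto intro: add_nonneg_pos add_mono)
  qed
qed simp

lemma cfrac_value_Cons: "cfrac_value (x # xs) = of_int x + cfrac_value (0 # xs)"
  by (cases xs) auto

lemma cfrac_value_convergents:
  assumes "convergents xs p' p q' q" and "\<forall>x\<in>set xs. 0 < x"
  shows "cfrac_value (0 # xs) = of_int p / of_int q"
  using assms
proof (induction rule: convergents.induct)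
  case (Cons xs p' p q' q x)
  then have "0 < q"
    using convergents_nonneg by auto
  have "cfrac_value (0 # x # xs) = 1 / (of_int x + of_int p / of_int q)"
    using Cons cfrac_value_Cons[of x xs] by simp
  also have "\<dots> = of_int q / of_int (p + x * q)"
    using \<open>0 < q\<close> by (simp add: field_simps)
  finally show ?case .
qed simp

lemma convergents_eqI:
  assumes "odd (length xs)" and "\<forall>x\<in>set xs. 0 < x"
    and "of_int a / of_int b = cfrac_value (0 # xs)"
    and "a * a' = 1 + k * b" and "0 < a'" and "a' \<le> b"
  shows "convergents xs k a a' b"
proof -
  obtain p' p q' q where conv: "convergents xs p' p q' q"
    using convergents_exist by blast
  note nonneg = convergents_nonneg[OF conv assms(2)]
  have mono: "0 < q'" "q' \<le> q"
    using convergents_mono[OF conv assms(2)] assms(1) by fastforce+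
  have det: "q' * p - q * p' = 1"
    using convergents_det[OF conv] assms(1) by (simp add: algebra_simps)
  have det': "a' * a - b * k = 1"
    using assms(4) by (simp add: algebra_simps)
  have "of_int a / of_int b = (of_int p / of_int q :: rat)"
    using assms(3) cfrac_value_convergents[OF conv assms(2)] by simp
  moreover have "coprime a b" "coprime p q"
    using coprime_if_det_eq_1[of a' a k b] coprime_if_det_eq_1[of q' p p' q] det det'
    by (simp_all add: mult.commute coprime_commute)
  ultimately have "a = p" "b = q"
    using coprime_fraction_unique nonneg assms(5,6) by auto
  moreover from this have "a' = q'" "k = p'"
    using bezout_coefficients_unique[of a a' k b q' p'] det det' mono assms(5,6)
    by (simp_all add: mult.commute)
  ultimately show ?thesis
    using conv by simp
qed

section \<open>Alternating sums of partial quotients\<close>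

text \<open>The alternating sum \<open>x\<^sub>1 - x\<^sub>2 + x\<^sub>3 - \<dots>\<close> is \<open>foldr (-) xs 0\<close>. For odd length the
  determinant of the convergents is \<open>-1\<close>, so the rows are swapped to land in \<open>SL\<^sub>2(\<int>)\<close>.\<close>

lemma foldr_minus_cong_sl2_character:
  assumes "convergents xs p' p q' q"
  shows "if even (length xs) then [foldr (-) xs 0 = - sl2_character p' p q' q] (mod 12)
         else [foldr (-) xs 0 = sl2_character q' q p' p] (mod 12)"
  using assms
proof (induction rule: convergents.induct)
  case Nil
  then show ?case by (simp add: sl2_character_def)
next
  case (Cons xs p' p q' q x)
  note det = convergents_det[OF Cons.hyps]
  show ?case
  proof (cases "even (length xs)")
    case True
    then have "[x - foldr (-) xs 0 = x - - sl2_character p' p q' q] (mod 12)"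
      using Cons.IH by (intro cong_diff cong_refl) simp
    also have "[x - - sl2_character p' p q' q =
        sl2_character (p' + x * q') (p + x * q) q' q] (mod 12)"
      using sl2_character_upper_unipotent[of p' q p q' x] det True
      by (simp add: cong_sym_eq add.commute)
    finally show ?thesis
      using True by simp
  next
    case False
    then have "[x - foldr (-) xs 0 = x - sl2_character q' q p' p] (mod 12)"
      using Cons.IH by (intro cong_diff cong_refl) simp
    also have "[x - sl2_character q' q p' p =
        - sl2_character q' q (p' + x * q') (p + x * q)] (mod 12)"
      using cong_uminus[OF sl2_character_lower_unipotent[of q' p q p' x]] det False
      by (simp add: cong_sym_eq algebra_simps)
    finally show ?thesis
      using False by simp
  qed
qed

lemma alternating_sum_nth_eq_foldr:
  fixes xs :: "'a::comm_ring_1 list"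
  shows "(\<Sum>i<length xs. (- 1) ^ i * xs ! i) = foldr (-) xs 0"
  by (induction xs) (simp_all add: sum.lessThan_Suc_shift sum_negf del: sum.lessThan_Suc)

lemma cfrac_alt_sum_eq_foldr: "cfrac_alt_sum n q = foldr (-) (map q [1..<n + 1]) 0"
proof -
  have "cfrac_alt_sum n q = (\<Sum>i<n. (- 1) ^ i * q (Suc i))"
    by (simp add: cfrac_alt_sum_def sum.atLeast1_atMost_eq)
  also have "\<dots> = foldr (-) (map q [1..<n + 1]) 0"
    by (simp flip: alternating_sum_nth_eq_foldr del: upt_Suc)
  finally show ?thesis .
qed

lemma cfrac_sum_cong_cfrac_alt_sum: "[cfrac_sum n q = cfrac_alt_sum n q] (mod 2)"
  unfolding cfrac_sum_def cfrac_alt_sum_def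
  by (intro cong_sum) (auto simp: minus_one_power_iff cong_iff_dvd_diff)

lemma cfrac_alt_sum_cong_sl2_character:
  assumes "odd_cfrac_expansion a b n q" and "a * a' = 1 + k * b" and "0 < a'" and "a' \<le> b"
  shows "[cfrac_alt_sum n q = sl2_character a' b k a] (mod 12)"
proof -
  have "odd n" "\<forall>x\<in>set (map q [1..<n + 1]). 0 < x"
    "of_int a / of_int b = cfrac_value (0 # map q [1..<n + 1])"
    using assms(1) by (auto simp: odd_cfrac_expansion_def simp del: upt_Suc)
  then have "convergents (map q [1..<n + 1]) k a a' b" "odd (length (map q [1..<n + 1]))"
    using assms(2-4) by (auto intro!: convergents_eqI simp del: upt_Suc)
  then show ?thesis
    using foldr_minus_cong_sl2_character unfolding cfrac_alt_sum_eq_foldr by metis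
qed

theorem theorem1:
  fixes a b a' k T D :: int and n :: nat and q :: "nat \<Rightarrow> int"
  assumes "0 < a" and "a < b" and "gcd a b = 1"
    and "odd_cfrac_expansion a b n q"
    and "0 < a'" and "a' < b" and "[a * a' = 1] (mod b)"
    and "a * a' = 1 + k * b"
    and "T = cfrac_alt_sum n q"
    and "D = cfrac_sum n q"
  shows "([a = 1] (mod 4) \<or> [a' = 1] (mod 4) \<longrightarrow> [T = b - k] (mod 4)) \<and>
         ([a = 3] (mod 4) \<or> [a' = 3] (mod 4) \<longrightarrow> [T = 2 + k - b] (mod 4)) \<and>
         ([a = 2] (mod 4) \<or> [a' = 2] (mod 4) \<longrightarrow>
            even (b - k) \<and> [D = (b - k) div 2] (mod 2))"
proof -
  have det: "a' * a - b * k = 1" "a * a' - b * k = 1"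
    using assms(8) by (simp_all add: algebra_simps)
  have "[T = sl2_character a' b k a] (mod 12)"
    using cfrac_alt_sum_cong_sl2_character assms(4-6,8,9) by simp
  moreover from this have "[T = sl2_character a b k a'] (mod 12)"
    using sl2_character_swap_diagonal[OF det(1)] cong_sym cong_trans by blast
  ultimately have T: "[T = sl2_character a' b k a] (mod 4)" "[T = sl2_character a b k a'] (mod 4)"
    by (simp_all add: cong_12_iff)
  have odd_case: "[T = r * (b - k - 1) + 1] (mod 4)"
    if "odd r" "[a = r] (mod 4) \<or> [a' = r] (mod 4)" for r
    using that T det sl2_character_mod_4_diagonal_odd by (blast intro: cong_trans)
  have "[2 * T = b - k] (mod 4)" if "[a = 2] (mod 4) \<or> [a' = 2] (mod 4)"
    using that T det sl2_character_mod_4_diagonal_2 by (blast intro: cong_trans cong_scalar_left)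
  moreover have "[D = T] (mod 2)"
    using cfrac_sum_cong_cfrac_alt_sum assms(9,10) by simp
  ultimately have "even (b - k) \<and> [D = (b - k) div 2] (mod 2)"
    if "[a = 2] (mod 4) \<or> [a' = 2] (mod 4)"
    using that cong_half[of T "b - k" 2] cong_trans by auto
  moreover have "[3 * (b - k - 1) + 1 = 2 + k - b] (mod 4)"
    by (simp add: cong_iff_dvd_diff)
  ultimately show ?thesis
    using odd_case[of 1] odd_case[of 3] cong_trans by auto
qed

end
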